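(* Let $\mathcal{H}$ be a separable complex Hilbert space, let $F=\{f_k\}_{k=1}^\infty$ be a Riesz basis for $\mathcal{H}$ with frame operator $S_F$, and let $\{g_k\}_{k=1}^\infty$ be a sequence in $\mathcal{H}$. Then the following statements are equivalent. (i) The pair $(\{f_k\}_{k=1}^\infty,\{g_k\}_{k=1}^\infty)$ is a biframe for $\mathcal{H}$. (ii) There exists $Q\in B^{+}_{b.b.}(\mathcal{H})$ such that $g_k=(S_FQ)^{-1}f_k$ for all $k\in\mathbb{N}$. In particular, each of conditions (i) and (ii) implies that $\{g_k\}_{k=1}^\infty$ is a Riesz basis for $\mathcal{H}$.
   Context: A pair $(\{f_k\}_{k=1}^\infty,\{g_k\}_{k=1}^\infty)$ of sequences in $\mathcal{H}$ is a biframe for $\mathcal{H}$ if there exist constants $A,B>0$ such that $A\|f\|^2\le\sum_{k=1}^\infty\langle f,f_k\rangle\langle g_k,f\rangle\le B\|f\|^2$ for all $f\in\mathcal{H}$ (the series converging to a real number). A Riesz basis for $\mathcal{H}$ is a sequence $\{Ue_k\}_{k=1}^\infty$ with $\{e_k\}_{k=1}^\infty$ an orthonormal basis and $U$ an invertible bounded linear operator on $\mathcal{H}$; its frame operator is $S_Ff=\sum_k\langle f,f_k\rangle f_k$. $B^{+}_{b.b.}(\mathcal{H})$ is the set of bounded, self-adjoint, positive operators on $\mathcal{H}$ that are bounded below ($\exists\alpha>0$: $\alpha\|f\|\le\|Qf\|$ for all $f$). The inner product is linear in the first variable. *)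

theory Defs
  imports "HOL-Analysis.Analysis"
begin

class complex_vector = real_vector +
  fixes scaleC :: "complex \<Rightarrow> 'a \<Rightarrow> 'a"  (infixr \<open>*\<^sub>C\<close> 75)
  assumes scaleR_eq_scaleC: "r *\<^sub>R x = complex_of_real r *\<^sub>C x"
    and scaleC_add_right: "c *\<^sub>C (x + y) = c *\<^sub>C x + c *\<^sub>C y"
    and scaleC_add_left: "(c + d) *\<^sub>C x = c *\<^sub>C x + d *\<^sub>C x"
    and scaleC_scaleC: "c *\<^sub>C (d *\<^sub>C x) = (c * d) *\<^sub>C x"
    and scaleC_one: "1 *\<^sub>C x = x"

lemma vector_space_scaleC: "vector_space (scaleC :: complex \<Rightarrow> 'a \<Rightarrow> 'a::complex_vector)"
  by unfold_locales (simp_all add: scaleC_add_right scaleC_add_left scaleC_scaleC scaleC_one)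

text \<open>The inner product is linear in the first variable.\<close>

class complex_inner = complex_vector + real_normed_vector +
  fixes cinner :: "'a \<Rightarrow> 'a \<Rightarrow> complex"
  assumes cinner_commute: "cinner x y = cnj (cinner y x)"
    and cinner_add_left: "cinner (x + y) z = cinner x z + cinner y z"
    and cinner_scaleC_left: "cinner (c *\<^sub>C x) y = c * cinner x y"
    and cinner_ge_zero: "0 \<le> Re (cinner x x)"
    and cinner_eq_zero_iff: "cinner x x = 0 \<longleftrightarrow> x = 0"
    and norm_eq_sqrt_cinner: "norm x = sqrt (Re (cinner x x))"

class chilbert_space = complex_inner + banach

definition bounded_clinear :: "('a::complex_inner \<Rightarrow> 'b::complex_inner) \<Rightarrow> bool" where
  "bounded_clinear T \<longleftrightarrow> bounded_linear T \<and> (\<forall>c x. T (c *\<^sub>C x) = c *\<^sub>C T x)"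

definition invertible_bounded_clinear :: "('a::complex_inner \<Rightarrow> 'a) \<Rightarrow> bool" where
  "invertible_bounded_clinear U \<longleftrightarrow>
     bounded_clinear U \<and> (\<exists>V. bounded_clinear V \<and> V \<circ> U = id \<and> U \<circ> V = id)"

definition is_adjoint :: "('a::complex_inner \<Rightarrow> 'a) \<Rightarrow> ('a \<Rightarrow> 'a) \<Rightarrow> bool" where
  "is_adjoint T T' \<longleftrightarrow> (\<forall>x y. cinner (T x) y = cinner x (T' y))"

definition self_adjoint :: "('a::complex_inner \<Rightarrow> 'a) \<Rightarrow> bool" where
  "self_adjoint T \<longleftrightarrow> is_adjoint T T"

definition positive_operator :: "('a::complex_inner \<Rightarrow> 'a) \<Rightarrow> bool" where
  "positive_operator T \<longleftrightarrow> (\<forall>x. cinner (T x) x \<in> \<real> \<and> 0 \<le> Re (cinner (T x) x))"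

definition bounded_below_operator :: "('a::complex_inner \<Rightarrow> 'a) \<Rightarrow> bool" where
  "bounded_below_operator T \<longleftrightarrow> (\<exists>\<alpha>>0. \<forall>x. \<alpha> * norm x \<le> norm (T x))"

definition Bbb_pos :: "('a::complex_inner \<Rightarrow> 'a) set" where
  "Bbb_pos = {Q. bounded_clinear Q \<and> self_adjoint Q \<and> positive_operator Q
                 \<and> bounded_below_operator Q}"

text \<open>Sequences are indexed by \<^typ>\<open>nat\<close>, so the index set is shifted to start at 0.\<close>

definition orthonormal_basis :: "(nat \<Rightarrow> 'a::complex_inner) \<Rightarrow> bool" where
  "orthonormal_basis e \<longleftrightarrow>
     (\<forall>i j. cinner (e i) (e j) = (if i = j then 1 else 0))
     \<and> closure (module.span scaleC (range e)) = UNIV"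

definition riesz_basis :: "(nat \<Rightarrow> 'a::chilbert_space) \<Rightarrow> bool" where
  "riesz_basis f \<longleftrightarrow>
     (\<exists>U e. invertible_bounded_clinear U \<and> orthonormal_basis e \<and> (\<forall>k. f k = U (e k)))"

definition frame_operator :: "(nat \<Rightarrow> 'a::chilbert_space) \<Rightarrow> 'a \<Rightarrow> 'a" where
  "frame_operator f x = (\<Sum>k. cinner x (f k) *\<^sub>C f k)"

text \<open>The series is complex; \<open>s\<close> is its sum, which is required to be real.\<close>

definition biframe :: "(nat \<Rightarrow> 'a::chilbert_space) \<Rightarrow> (nat \<Rightarrow> 'a) \<Rightarrow> bool" where
  "biframe f g \<longleftrightarrow>
     (\<exists>A>0. \<exists>B>0. \<forall>x. \<exists>s::real.
        (\<lambda>k. cinner x (f k) * cinner (g k) x) sums complex_of_real s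
        \<and> A * (norm x)\<^sup>2 \<le> s \<and> s \<le> B * (norm x)\<^sup>2)"

text \<open>
  For a Riesz basis \<open>f\<close> and \<open>Q \<in> Bbb_pos\<close> the map \<open>frame_operator f \<circ> Q\<close> is a bijection,
  so \<open>inv (frame_operator f \<circ> Q)\<close> is its genuine two-sided inverse.
\<close>

end

theory Submission
  imports Defs
begin

text \<open>
  Write \<open>f\<^sub>k = U e\<^sub>k\<close> and let \<open>d\<^sub>k = (U\<^sup>*)\<^sup>-\<^sup>1 e\<^sub>k\<close> be the dual basis, so that \<open>S\<^sub>F = U U\<^sup>*\<close>
  and \<open>S\<^sub>F d\<^sub>k = f\<^sub>k\<close>. Hence \<open>g\<^sub>k = (S\<^sub>F Q)\<^sup>-\<^sup>1 f\<^sub>k\<close> says \<open>g\<^sub>k = Q\<^sup>-\<^sup>1 d\<^sub>k\<close>, and the biframe series at \<open>x\<close>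
  is then \<open>\<langle>Q\<^sup>-\<^sup>1 x, x\<rangle>\<close>. Conversely, a biframe makes the sesquilinear form
  \<open>(\<Sum>a\<^sub>k d\<^sub>k, \<Sum>b\<^sub>k d\<^sub>k) \<mapsto> \<langle>\<Sum>a\<^sub>k g\<^sub>k, \<Sum>b\<^sub>k d\<^sub>k\<rangle>\<close> positive and bounded on the diagonal; the
  Cauchy-Schwarz inequality for this form shows that \<open>d\<^sub>k \<mapsto> g\<^sub>k\<close> extends to a bounded operator,
  which is coercive and hence invertible, and \<open>Q\<close> is its inverse.
\<close>

section \<open>Complex inner product spaces\<close>

lemma scaleC_scaleR_commute: "c *\<^sub>C (r *\<^sub>R x) = r *\<^sub>R (c *\<^sub>C (x::'a::complex_vector))"
  by (simp add: scaleR_eq_scaleC scaleC_scaleC mult.commute)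

lemma scaleC_zero_left [simp]: "0 *\<^sub>C (x::'a::complex_vector) = 0"
  using scaleC_add_left[of 0 0 x] by simp

lemma scaleC_one_left [simp]: "1 *\<^sub>C (x::'a::complex_vector) = x"
  by (rule scaleC_one)

lemma cinner_add_right: "cinner x (y + z) = cinner x y + cinner x (z::'a::complex_inner)"
  by (metis cinner_add_left cinner_commute complex_cnj_add)

lemma cinner_scaleC_right: "cinner x (c *\<^sub>C y) = cnj c * cinner x (y::'a::complex_inner)"
  by (metis cinner_scaleC_left cinner_commute complex_cnj_mult)

lemma cinner_self: "cinner x x = complex_of_real ((norm (x::'a::complex_inner))\<^sup>2)"
proof (rule complex_eqI)
  show "Re (cinner x x) = Re (complex_of_real ((norm x)\<^sup>2))"
    using cinner_ge_zero[of x] by (simp add: norm_eq_sqrt_cinner)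
  show "Im (cinner x x) = Im (complex_of_real ((norm x)\<^sup>2))"
    using arg_cong[OF cinner_commute[of x x], of Im] by simp
qed

lemma norm_scaleC: "norm (c *\<^sub>C x) = cmod c * norm (x::'a::complex_inner)"
proof -
  have "complex_of_real ((norm (c *\<^sub>C x))\<^sup>2) = c * cnj c * cinner x x"
    by (subst cinner_self[symmetric]) (simp add: cinner_scaleC_left cinner_scaleC_right)
  also have "\<dots> = complex_of_real ((cmod c * norm x)\<^sup>2)"
    by (simp add: cinner_self power_mult_distrib flip: complex_norm_square)
  finally have "(norm (c *\<^sub>C x))\<^sup>2 = (cmod c * norm x)\<^sup>2"
    using of_real_eq_iff by blast
  then show ?thesis by (simp add: power2_eq_iff_nonneg)
qed

text \<open>
  Cauchy-Schwarz for a single pair of vectors of a form \<open>b\<close>: here \<open>p = b x x\<close>, \<open>w = b x y\<close>,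
  \<open>w' = b y x\<close>, \<open>q = b y y\<close>, and the assumption says that \<open>b\<close> is real and nonnegative at \<open>x + c y\<close>.
\<close>

lemma hermitian_cauchy_schwarz:
  fixes p q w w' :: complex
  assumes form: "\<And>c. p + cnj c * w + c * w' + c * cnj c * q \<in> \<real>
                  \<and> 0 \<le> Re (p + cnj c * w + c * w' + c * cnj c * q)"
    and pq: "Im p = 0" "Im q = 0" "0 \<le> Re q"
  shows "w' = cnj w" and "(cmod w)\<^sup>2 \<le> Re p * Re q"
proof -
  \<comment> \<open>Reality at \<open>c = 1\<close> fixes the sum of the imaginary parts, reality at
    the imaginary unit fixes the difference of the real parts.\<close>
  have 1: "Im w + Im w' = 0" using form[of 1] pq by (simp add: complex_is_Real_iff)
  have 2: "Re w' - Re w = 0" using form[of \<i>] pq by (simp add: complex_is_Real_iff)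
  show w': "w' = cnj w" using 1 2 by (simp add: complex_eq_iff)
  \<comment> \<open>Choosing \<open>c = - t w\<close> with \<open>t\<close> real aligns the phases
    and leaves a real quadratic in \<open>t\<close>.\<close>
  have ineq: "0 \<le> Re p - 2 * t * (cmod w)\<^sup>2 + t\<^sup>2 * (cmod w)\<^sup>2 * Re q" for t :: real
  proof -
    have "Re (p + cnj c * w + c * w' + c * cnj c * q)
            = Re p - 2 * t * (cmod w)\<^sup>2 + t\<^sup>2 * (cmod w)\<^sup>2 * Re q"
      if "c = - (complex_of_real t * w)" for c
      unfolding that w' cmod_power2 using pq by (simp add: algebra_simps power2_eq_square)
    then show ?thesis using form[of "- (complex_of_real t * w)"] by simp
  qed
  show "(cmod w)\<^sup>2 \<le> Re p * Re q"
  proof (cases "Re q = 0")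
    case True
    have "w = 0"
    proof (rule ccontr)
      assume "w \<noteq> 0"
      \<comment> \<open>This \<open>t\<close> makes the now linear expression equal to -1.\<close>
      then show False
        using ineq[of "(Re p + 1) / (2 * (cmod w)\<^sup>2)"] True by simp
    qed
    then show ?thesis using True by simp
  next
    case False
    \<comment> \<open>\<open>t = 1 / Re q\<close> is the minimiser of the quadratic.\<close>
    have "0 \<le> Re p - (cmod w)\<^sup>2 / Re q"
      using ineq[of "1 / Re q"] False by (simp add: power2_eq_square field_simps)
    then show ?thesis using False pq by (simp add: field_simps)
  qed
qed

lemma cinner_cauchy_schwarz: "cmod (cinner x y) \<le> norm x * norm (y::'a::complex_inner)"
proof -
  have "cinner x x + cnj c * cinner x y + c * cinner y x + c * cnj c * cinner y y
          = complex_of_real ((norm (x + c *\<^sub>C y))\<^sup>2)" for c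
    by (subst cinner_self[symmetric]) (simp add: cinner_add_left cinner_add_right
        cinner_scaleC_left cinner_scaleC_right algebra_simps)
  then have "(cmod (cinner x y))\<^sup>2 \<le> Re (cinner x x) * Re (cinner y y)"
    by (intro hermitian_cauchy_schwarz(2)[where w' = "cinner y x"]) (simp_all add: cinner_self)
  then have "(cmod (cinner x y))\<^sup>2 \<le> (norm x * norm y)\<^sup>2"
    by (simp add: cinner_self power_mult_distrib)
  then show ?thesis by (rule power2_le_imp_le) simp
qed

lemma bounded_bilinear_cinner: "bounded_bilinear (cinner :: 'a::complex_inner \<Rightarrow> 'a \<Rightarrow> complex)"
proof
  show "\<exists>K. \<forall>a b::'a. norm (cinner a b) \<le> norm a * norm b * K"
    by (rule exI[of _ 1]) (simp add: cinner_cauchy_schwarz)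
qed (simp_all add: cinner_add_left cinner_add_right scaleR_eq_scaleC cinner_scaleC_left
    cinner_scaleC_right scaleR_conv_of_real)

interpretation cinner: bounded_bilinear "cinner :: 'a::complex_inner \<Rightarrow> 'a \<Rightarrow> complex"
  by (rule bounded_bilinear_cinner)

lemma bounded_linear_scaleC: "bounded_linear (\<lambda>x::'a::complex_inner. c *\<^sub>C x)"
  by (rule bounded_linear_intro[where K = "cmod c"])
    (simp_all add: scaleC_add_right scaleC_scaleR_commute norm_scaleC)

lemma cinner_eqI:
  assumes "\<And>z. cinner z x = cinner z (y::'a::complex_inner)"
  shows "x = y"
  using assms[of "x - y"] cinner_eq_zero_iff[of "x - y"] by (simp add: cinner.diff_right)

section \<open>Bounded complex-linear operators, their inverses and adjoints\<close>

lemma bounded_clinearI: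
  assumes "\<And>x y. T (x + y) = T x + T y" "\<And>c x. T (c *\<^sub>C x) = c *\<^sub>C T x"
    and "\<And>x. norm (T x) \<le> K * norm x"
  shows "bounded_clinear T"
  unfolding bounded_clinear_def
  using assms by (auto intro!: bounded_linear_intro[where K = K] simp: scaleR_eq_scaleC mult.commute)

lemma bounded_clinear_bounded_linear: "bounded_clinear T \<Longrightarrow> bounded_linear T"
  by (simp add: bounded_clinear_def)

lemma bounded_clinear_scaleC: "bounded_clinear T \<Longrightarrow> T (c *\<^sub>C x) = c *\<^sub>C T x"
  by (simp add: bounded_clinear_def)

lemma bounded_clinear_add: "bounded_clinear T \<Longrightarrow> T (x + y) = T x + T y"
  by (simp add: bounded_clinear_def linear_simps(1))

lemma bounded_clinear_compose:
  "bounded_clinear S \<Longrightarrow> bounded_clinear T \<Longrightarrow> bounded_clinear (S \<circ> T)"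
  unfolding bounded_clinear_def o_def by (auto intro: bounded_linear_compose)

lemma invertible_bounded_clinear_compose:
  assumes "invertible_bounded_clinear S" "invertible_bounded_clinear T"
  shows "invertible_bounded_clinear (S \<circ> T)"
proof -
  obtain S' T' where *: "bounded_clinear S'" "S' \<circ> S = id" "S \<circ> S' = id"
      "bounded_clinear T'" "T' \<circ> T = id" "T \<circ> T' = id"
    using assms unfolding invertible_bounded_clinear_def by blast
  have "(T' \<circ> S') \<circ> (S \<circ> T) = id" "(S \<circ> T) \<circ> (T' \<circ> S') = id"
    using * by (simp_all add: fun_eq_iff)
  then show ?thesis
    using assms * unfolding invertible_bounded_clinear_def
    by (blast intro: bounded_clinear_compose)
qed

text \<open>Linearity follows by testing against all vectors. The bound comes from
  \<open>(norm (T' y))^2 = |cinner (T (T' y)) y|\<close>, where one factor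
  \<open>norm (T' y)\<close> cancels.\<close>

lemma bounded_clinear_adjoint:
  assumes T: "bounded_clinear T" and adj: "is_adjoint T T'"
  shows "bounded_clinear T'"
proof -
  have adj: "cinner x (T' y) = cinner (T x) y" for x y
    using adj by (simp add: is_adjoint_def)
  obtain K where K: "K \<ge> 0" "\<And>x. norm (T x) \<le> norm x * K"
    using bounded_linear.nonneg_bounded[OF bounded_clinear_bounded_linear[OF T]] by blast
  show ?thesis
  proof (rule bounded_clinearI)
    show "T' (x + y) = T' x + T' y" for x y
      by (rule cinner_eqI) (simp add: adj cinner_add_right)
    show "T' (c *\<^sub>C x) = c *\<^sub>C T' x" for c x
      by (rule cinner_eqI) (simp add: adj cinner_scaleC_right)
    show "norm (T' y) \<le> K * norm y" for y
    proof -
      have "(norm (T' y))\<^sup>2 = cmod (cinner (T (T' y)) y)"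
        by (simp add: adj[symmetric] cinner_self norm_power)
      also have "\<dots> \<le> norm (T (T' y)) * norm y" by (rule cinner_cauchy_schwarz)
      also have "\<dots> \<le> norm (T' y) * K * norm y" by (intro mult_right_mono K) simp
      finally show ?thesis
        using K(1) by (cases "T' y = 0") (simp_all add: power2_eq_square mult.assoc)
    qed
  qed
qed

text \<open>\<open>T' \<circ> S'\<close> is an adjoint of \<open>S \<circ> T\<close>. Used on both
  sides, this makes the adjoint of an inverse the inverse of the adjoint.\<close>

lemma is_adjoint_compose_id:
  assumes "is_adjoint S S'" "is_adjoint T T'" "S \<circ> T = id"
  shows "T' \<circ> S' = id"
proof
  fix x
  show "(T' \<circ> S') x = id x"
    using assms unfolding is_adjoint_def by (intro cinner_eqI) (metis comp_apply id_apply)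
qed

section \<open>Coercive operators\<close>

text \<open>Cauchy-Schwarz, with one factor \<open>norm x\<close> cancelled. It yields injectivity
  and the bound on the inverse below.\<close>

lemma coercive_norm_ge:
  assumes "\<And>x. A * (norm x)\<^sup>2 \<le> Re (cinner (T x) x)"
  shows "A * norm (x::'a::complex_inner) \<le> norm (T x)"
proof (cases "x = 0")
  case False
  have "A * (norm x)\<^sup>2 \<le> Re (cinner (T x) x)" by (rule assms)
  also have "\<dots> \<le> norm (T x) * norm x"
    using complex_Re_le_cmod cinner_cauchy_schwarz order_trans by blast
  finally show ?thesis using False by (simp add: power2_eq_square mult.assoc[symmetric])
qed simp

text \<open>
  Surjectivity: for small \<open>t\<close>, the map \<open>x \<mapsto> x - t (T x - y)\<close> is a contraction, and its fixed
  point solves \<open>T x = y\<close>.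
\<close>

lemma invertible_if_coercive:
  fixes T :: "'a::chilbert_space \<Rightarrow> 'a"
  assumes T: "bounded_clinear T" and A: "A > 0"
    and coercive: "\<And>x. A * (norm x)\<^sup>2 \<le> Re (cinner (T x) x)"
  shows "invertible_bounded_clinear T"
proof -
  interpret T: bounded_linear T by (rule bounded_clinear_bounded_linear[OF T])
  obtain K0 where K0: "K0 > 0" "\<And>x. norm (T x) \<le> norm x * K0"
    using T.pos_bounded by blast
  \<comment> \<open>Adding \<open>A\<close> makes \<open>A / K < 1\<close> strict, so that the
    square root defining \<open>r\<close> is a genuine one.\<close>
  define K where "K = K0 + A"
  have K: "K > 0" "A < K" using K0 A by (auto simp: K_def)
  have TK: "norm (T x) \<le> K * norm x" for x
  proof -
    have "norm x * K0 \<le> K * norm x" using A by (simp add: K_def algebra_simps)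
    then show ?thesis using K0(2)[of x] by linarith
  qed
  \<comment> \<open>This \<open>t\<close> minimises \<open>1 - 2 * t * A + t^2 * K^2\<close>, and
    the minimum is \<open>r^2\<close>.\<close>
  define t where "t = A / K\<^sup>2"
  define r where "r = sqrt (1 - (A / K)\<^sup>2)"
  have AK: "0 < (A / K)\<^sup>2" "(A / K)\<^sup>2 < 1"
    using A K by (simp_all add: power_less_one_iff)
  have r: "0 \<le> r" "r < 1" using AK by (simp_all add: r_def)
  have contr: "norm (x - t *\<^sub>R T x) \<le> r * norm x" for x
  proof -
    have "complex_of_real ((norm (x - t *\<^sub>R T x))\<^sup>2)
        = cinner x x - of_real t * (cinner (T x) x + cinner x (T x)) + (of_real t)\<^sup>2 * cinner (T x) (T x)"
      by (subst cinner_self[symmetric]) (simp add: cinner.diff_left cinner.diff_right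
          cinner.scaleR_left cinner.scaleR_right scaleR_conv_of_real algebra_simps power2_eq_square)
    from arg_cong[OF this, of Re]
    have "(norm (x - t *\<^sub>R T x))\<^sup>2
        = (norm x)\<^sup>2 - 2 * t * Re (cinner (T x) x) + t\<^sup>2 * (norm (T x))\<^sup>2"
      using arg_cong[OF cinner_commute[of x "T x"], of Re]
      by (simp add: cinner_self flip: of_real_power)
    moreover have "2 * t * (A * (norm x)\<^sup>2) \<le> 2 * t * Re (cinner (T x) x)"
      using A K coercive[of x] by (intro mult_left_mono) (simp_all add: t_def)
    moreover have "t\<^sup>2 * (norm (T x))\<^sup>2 \<le> t\<^sup>2 * (K * norm x)\<^sup>2"
      using TK[of x] by (intro mult_left_mono power_mono) simp_all
    moreover have "(norm x)\<^sup>2 - 2 * t * (A * (norm x)\<^sup>2) + t\<^sup>2 * (K * norm x)\<^sup>2 = (r * norm x)\<^sup>2"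
    proof -
      have "t * A = (A / K)\<^sup>2" "t\<^sup>2 * K\<^sup>2 = (A / K)\<^sup>2" "r\<^sup>2 = 1 - (A / K)\<^sup>2"
        using AK K by (simp_all add: t_def r_def power2_eq_square)
      moreover have "(norm x)\<^sup>2 - 2 * t * (A * (norm x)\<^sup>2) + t\<^sup>2 * (K * norm x)\<^sup>2
          = (1 - 2 * (t * A) + t\<^sup>2 * K\<^sup>2) * (norm x)\<^sup>2"
        by (simp add: algebra_simps)
      ultimately show ?thesis by (simp add: power_mult_distrib)
    qed
    ultimately have "(norm (x - t *\<^sub>R T x))\<^sup>2 \<le> (r * norm x)\<^sup>2" by linarith
    then show ?thesis
      by (rule power2_le_imp_le) (simp add: r)
  qed
  have surj: "\<exists>x. T x = y" for y
  proof -
    have "\<exists>!x\<in>UNIV. x - t *\<^sub>R (T x - y) = x"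
    proof (rule Banach_fix[where c = r])
      show "dist (x - t *\<^sub>R (T x - y)) (z - t *\<^sub>R (T z - y)) \<le> r * dist x z" for x z
      proof -
        have "(x - t *\<^sub>R (T x - y)) - (z - t *\<^sub>R (T z - y)) = (x - z) - t *\<^sub>R T (x - z)"
          by (simp add: T.diff algebra_simps)
        then show ?thesis using contr[of "x - z"] by (simp only: dist_norm)
      qed
    qed (use r in \<open>simp_all add: complete_UNIV\<close>)
    then obtain x where "x - t *\<^sub>R (T x - y) = x" by blast
    then have "T x = y" using A K by (simp add: t_def)
    then show ?thesis ..
  qed
  have inj: "inj T"
  proof (rule injI)
    fix x y assume "T x = T y"
    then have "A * norm (x - y) \<le> 0"
      using coercive_norm_ge[OF coercive, of "x - y"] by (simp add: T.diff)
    then show "x = y" using A by (simp add: mult_le_0_iff)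
  qed
  define V where "V = inv T"
  have TV: "T (V y) = y" for y unfolding V_def using surj by (metis surj_f_inv_f surj_def)
  have VT: "V (T x) = x" for x unfolding V_def using inj by simp
  have "bounded_clinear V"
  proof (rule bounded_clinearI)
    show "V (x + y) = V x + V y" for x y by (metis T.add TV VT)
    show "V (c *\<^sub>C x) = c *\<^sub>C V x" for c x by (metis bounded_clinear_scaleC[OF T] TV VT)
    show "norm (V x) \<le> (1 / A) * norm x" for x
      using coercive_norm_ge[OF coercive, of "V x"] A by (simp add: TV field_simps)
  qed
  then show ?thesis
    unfolding invertible_bounded_clinear_def using T TV VT by (auto simp: fun_eq_iff)
qed

section \<open>Positive operators and their coercivity\<close>

lemma cinner_form_expand:
  assumes "bounded_clinear T"
  shows "cinner (T x) x + cnj c * cinner (T x) y + c * cinner (T y) x + c * cnj c * cinner (T y) y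
    = cinner (T (x + c *\<^sub>C y)) (x + c *\<^sub>C y)"
  by (simp add: bounded_clinear_add[OF assms] bounded_clinear_scaleC[OF assms] cinner_add_left
      cinner_add_right cinner_scaleC_left cinner_scaleC_right algebra_simps)

text \<open>The form \<open>cinner (T x) y\<close> is real and nonnegative on the diagonal, which is
  all that the abstract inequality asks for.\<close>

lemma positive_operator_cauchy_schwarz:
  assumes T: "bounded_clinear T" and "positive_operator T"
  shows "cinner (T y) x = cnj (cinner (T x) y)"
    and "(cmod (cinner (T x) y))\<^sup>2 \<le> Re (cinner (T x) x) * Re (cinner (T y) y)"
  using assms(2) unfolding positive_operator_def
  by (auto intro!: hermitian_cauchy_schwarz[where q = "cinner (T y) y"
        and w' = "cinner (T y) x" and p = "cinner (T x) x"]
      simp: cinner_form_expand[OF T] complex_is_Real_iff)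

lemma positive_operator_self_adjoint:
  assumes "bounded_clinear T" "positive_operator T"
  shows "self_adjoint T"
  unfolding self_adjoint_def is_adjoint_def
  using positive_operator_cauchy_schwarz(1)[OF assms] cinner_commute by metis

text \<open>Cauchy-Schwarz for the form of \<open>Q\<close> at the pair \<open>x\<close>,
  \<open>Q x\<close> gives \<open>norm (Q x)^4 \<le> Re (cinner (Q x) x) * K * norm (Q x)^2\<close>.
  Cancelling and inserting the lower bound on \<open>norm (Q x)\<close> produces the constant
  \<open>\<alpha>^2 / K\<close>.\<close>

lemma Bbb_pos_coercive:
  assumes "Q \<in> Bbb_pos"
  obtains A where "A > 0" "\<And>x. A * (norm x)\<^sup>2 \<le> Re (cinner (Q x) x)"
proof -
  have Q: "bounded_clinear Q" "positive_operator Q" using assms by (auto simp: Bbb_pos_def)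
  obtain \<alpha> where \<alpha>: "\<alpha> > 0" "\<And>x. \<alpha> * norm x \<le> norm (Q x)"
    using assms by (auto simp: Bbb_pos_def bounded_below_operator_def)
  obtain K where K: "K > 0" "\<And>x. norm (Q x) \<le> norm x * K"
    using bounded_linear.pos_bounded[OF bounded_clinear_bounded_linear[OF Q(1)]] by blast
  have "\<alpha>\<^sup>2 / K * (norm x)\<^sup>2 \<le> Re (cinner (Q x) x)" for x
  proof (cases "x = 0")
    case False
    let ?n = "norm (Q x)" and ?p = "Re (cinner (Q x) x)"
    have n: "?n > 0" using \<alpha>(2)[of x] \<alpha>(1) False
      by (metis mult_pos_pos order_less_le_trans zero_less_norm_iff)
    have p: "0 \<le> ?p" using Q(2) by (simp add: positive_operator_def)
    have "(?n\<^sup>2)\<^sup>2 = (cmod (cinner (Q x) (Q x)))\<^sup>2"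
      by (simp add: cinner_self norm_power)
    also have "\<dots> \<le> ?p * Re (cinner (Q (Q x)) (Q x))"
      by (rule positive_operator_cauchy_schwarz(2)[OF Q])
    also have "\<dots> \<le> ?p * (norm (Q (Q x)) * ?n)"
      using complex_Re_le_cmod cinner_cauchy_schwarz order_trans
      by (intro mult_left_mono p) blast
    also have "\<dots> \<le> ?p * (?n * K * ?n)"
      by (intro mult_left_mono mult_right_mono p K) simp
    finally have "?n\<^sup>2 \<le> ?p * K"
      using n by (simp add: power2_eq_square mult.assoc mult.left_commute mult.commute[of K])
    moreover have "(\<alpha> * norm x)\<^sup>2 \<le> ?n\<^sup>2"
      using \<alpha> by (intro power_mono) auto
    ultimately show ?thesis using K(1) by (simp add: power_mult_distrib field_simps)
  qed (simp add: cinner.zero_right)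
  moreover have "\<alpha>\<^sup>2 / K > 0" using \<alpha> K by simp
  ultimately show ?thesis using that by blast
qed

section \<open>Orthonormal bases and adjoints\<close>

lemma scaleC_sum_right: "c *\<^sub>C (\<Sum>i\<in>I. f i) = (\<Sum>i\<in>I. c *\<^sub>C (f i::'a::complex_inner))"
  by (rule linear_sum[OF bounded_linear.linear[OF bounded_linear_scaleC]])

text \<open>Pythagoras; an arbitrary finite index set covers both partial sums and Cauchy
  blocks.\<close>

lemma orthonormal_norm_sum:
  assumes "\<And>i j. cinner (e i) (e j) = (if i = j then 1 else 0)" and I: "finite I"
  shows "(norm (\<Sum>k\<in>I. c k *\<^sub>C e k))\<^sup>2 = (\<Sum>k\<in>I. (cmod (c k))\<^sup>2)"
proof -
  have "cinner (\<Sum>k\<in>I. c k *\<^sub>C e k) (\<Sum>k\<in>I. c k *\<^sub>C e k) = (\<Sum>k\<in>I. c k * cnj (c k))"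
    using I by (simp add: cinner.sum_left cinner.sum_right cinner_scaleC_left cinner_scaleC_right
        assms(1) if_distrib[of "\<lambda>z. _ * z"] mult.commute cong: if_cong)
  then have "complex_of_real ((norm (\<Sum>k\<in>I. c k *\<^sub>C e k))\<^sup>2) = complex_of_real (\<Sum>k\<in>I. (cmod (c k))\<^sup>2)"
    by (simp only: cinner_self complex_norm_square[symmetric] of_real_sum)
  then show ?thesis using of_real_eq_iff by blast
qed

text \<open>By Pythagoras, bounded partial sums make the coefficients square summable, and the
  Cauchy criterion for their squares carries over to the vectors.\<close>

lemma orthonormal_summable:
  fixes e :: "nat \<Rightarrow> 'a::chilbert_space"
  assumes e: "\<And>i j. cinner (e i) (e j) = (if i = j then 1 else 0)"
    and M: "\<And>n. norm (\<Sum>k<n. c k *\<^sub>C e k) \<le> M"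
  shows "summable (\<lambda>k. c k *\<^sub>C e k)"
proof -
  have "(\<Sum>k<n. (cmod (c k))\<^sup>2) \<le> M\<^sup>2" for n
    using power_mono[OF M[of n], of 2] by (simp add: orthonormal_norm_sum[OF e])
  then have sq: "summable (\<lambda>k. (cmod (c k))\<^sup>2)"
    by (intro summableI_nonneg_bounded) auto
  show ?thesis
    unfolding summable_Cauchy
  proof (intro allI impI)
    fix \<epsilon> :: real assume \<epsilon>: "\<epsilon> > 0"
    then obtain N where N: "\<And>m n. m \<ge> N \<Longrightarrow> norm (\<Sum>k=m..<n. (cmod (c k))\<^sup>2) < \<epsilon>\<^sup>2"
      using sq unfolding summable_Cauchy by (meson zero_less_power)
    have "norm (\<Sum>k=m..<n. c k *\<^sub>C e k) < \<epsilon>" if "m \<ge> N" for m n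
    proof (rule power2_less_imp_less)
      show "(norm (\<Sum>k=m..<n. c k *\<^sub>C e k))\<^sup>2 < \<epsilon>\<^sup>2"
        using N[OF that, of n] by (simp add: orthonormal_norm_sum[OF e])
    qed (use \<epsilon> in simp)
    then show "\<exists>N. \<forall>m\<ge>N. \<forall>n. norm (\<Sum>k=m..<n. c k *\<^sub>C e k) < \<epsilon>" by blast
  qed
qed

text \<open>The finite sum \<open>p\<close> satisfies
  \<open>norm p^2 = |cinner y (T p)| \<le> K * norm y * norm p\<close>. For \<open>T = id\<close>
  this is Bessel's inequality; in general it bounds the partial sums of the series for the
  adjoint.\<close>

lemma orthonormal_bessel:
  assumes e: "\<And>i j. cinner (e i) (e j) = (if i = j then 1 else 0)"
    and T: "bounded_clinear T" and K: "K \<ge> 0" "\<And>x. norm (T x) \<le> K * norm x"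
    and I: "finite I"
  shows "norm (\<Sum>k\<in>I. cinner y (T (e k)) *\<^sub>C e k) \<le> K * norm y"
proof -
  let ?p = "\<Sum>k\<in>I. cinner y (T (e k)) *\<^sub>C e k"
  have "T ?p = (\<Sum>k\<in>I. cinner y (T (e k)) *\<^sub>C T (e k))"
    by (simp add: linear_sum[OF bounded_linear.linear[OF bounded_clinear_bounded_linear[OF T]]]
        bounded_clinear_scaleC[OF T])
  then have "cinner y (T ?p) = (\<Sum>k\<in>I. cinner y (T (e k)) * cnj (cinner y (T (e k))))"
    by (simp add: cinner.sum_right cinner_scaleC_right mult.commute)
  also have "\<dots> = complex_of_real ((norm ?p)\<^sup>2)"
    by (simp only: orthonormal_norm_sum[OF e I] complex_norm_square of_real_sum)
  finally have "(norm ?p)\<^sup>2 = cmod (cinner y (T ?p))" by (simp add: norm_power)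
  also have "\<dots> \<le> norm y * norm (T ?p)" by (rule cinner_cauchy_schwarz)
  also have "\<dots> \<le> norm y * (K * norm ?p)" by (intro mult_left_mono K) simp
  finally show ?thesis
    using K(1) by (cases "?p = 0") (simp_all add: power2_eq_square mult.assoc[symmetric] mult.commute)
qed

lemma bounded_clinear_id: "bounded_clinear id"
  by (rule bounded_clinearI[where K = 1]) simp_all

text \<open>The partial sums are contractions in \<open>y\<close> and converge on the dense span,
  hence everywhere.\<close>

lemma orthonormal_basis_sums:
  fixes e :: "nat \<Rightarrow> 'a::complex_inner"
  assumes "orthonormal_basis e"
  shows "(\<lambda>k. cinner y (e k) *\<^sub>C e k) sums y"
proof -
  interpret vector_space "scaleC :: complex \<Rightarrow> 'a \<Rightarrow> 'a" by (rule vector_space_scaleC)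
  have e: "\<And>i j. cinner (e i) (e j) = (if i = j then 1 else 0)"
    and dense: "closure (span (range e)) = UNIV"
    using assms by (auto simp: orthonormal_basis_def)
  define P where "P n y = (\<Sum>k<n. cinner y (e k) *\<^sub>C e k)" for n y
  have bessel: "norm (P n y) \<le> norm y" for n y
    using orthonormal_bessel[OF e bounded_clinear_id, of 1 "{..<n}" y] by (simp add: P_def)
  have diff: "P n (x - y) = P n x - P n y" for n x y
    by (simp add: P_def cinner.diff_left scale_left_diff_distrib sum_subtractf)
  have span: "(\<lambda>n. P n v) \<longlonglongrightarrow> v" if "v \<in> span (range e)" for v
    using that
  proof (induction rule: span_induct_alt)
    case base
    show ?case by (simp add: P_def cinner.zero_left)
  next
    case (step c x v)
    then obtain j where j: "x = e j" by blast
    have "P n (e j) = (if j < n then e j else 0)" for n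
      by (simp add: P_def e if_distrib[of "\<lambda>c. c *\<^sub>C _"] cong: if_cong)
    \<comment> \<open>The term \<open>e j\<close> enters the sum over \<open>k < n\<close> from
      \<open>n = Suc j\<close> on.\<close>
    then have "\<forall>\<^sub>F n in sequentially. P n (e j) = e j"
      by (auto simp: eventually_sequentially intro!: exI[of _ "Suc j"])
    then have "(\<lambda>n. P n (e j)) \<longlonglongrightarrow> e j" by (rule tendsto_eventually)
    then have "(\<lambda>n. c *\<^sub>C P n (e j) + P n v) \<longlonglongrightarrow> c *\<^sub>C e j + v"
      by (intro tendsto_add bounded_linear.tendsto[OF bounded_linear_scaleC] step)
    moreover have "P n (c *\<^sub>C e j + v) = c *\<^sub>C P n (e j) + P n v" for n
      by (simp add: P_def cinner_add_left cinner_scaleC_left scaleC_add_left scaleC_sum_right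
          scaleC_scaleC sum.distrib)
    ultimately show ?case by (simp add: j)
  qed
  have "(\<lambda>n. P n y) \<longlonglongrightarrow> y"
    unfolding LIMSEQ_iff
  proof (intro allI impI)
    fix \<epsilon> :: real assume \<epsilon>: "\<epsilon> > 0"
    have "y \<in> closure (span (range e))" by (simp add: dense)
    then obtain v where v: "v \<in> span (range e)" "norm (v - y) < \<epsilon> / 3"
      using \<epsilon> unfolding closure_approachable dist_norm by (meson divide_pos_pos zero_less_numeral)
    obtain N where N: "\<And>n. n \<ge> N \<Longrightarrow> norm (P n v - v) < \<epsilon> / 3"
      using LIMSEQ_D[OF span[OF v(1)], of "\<epsilon> / 3"] \<epsilon> by auto
    have "norm (P n y - y) < \<epsilon>" if "n \<ge> N" for n
    proof -
      have *: "P n y - y = (P n v - v) + (v - y) - P n (v - y)" by (simp add: diff)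
      have "norm (P n y - y) \<le> norm (P n v - v) + norm (v - y) + norm (P n (v - y))"
        unfolding *
        using norm_triangle_ineq4[of "P n v - v + (v - y)" "P n (v - y)"]
          norm_triangle_ineq[of "P n v - v" "v - y"] by linarith
      then show ?thesis using N[OF that] v(2) bessel[of n "v - y"] by linarith
    qed
    then show "\<exists>N. \<forall>n\<ge>N. norm (P n y - y) < \<epsilon>" by blast
  qed
  then show ?thesis by (simp add: sums_def P_def)
qed

text \<open>The coefficients of \<open>T' y\<close> have to be \<open>cinner y (T (e k))\<close>, so
  \<open>T'\<close> is defined by that series. The series stays in the conclusion because for
  \<open>T = U\<close> it leads to the frame operator.\<close>

lemma adjoint_exists:
  fixes e :: "nat \<Rightarrow> 'a::chilbert_space"
  assumes e: "orthonormal_basis e" and T: "bounded_clinear T"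
  obtains T' where "is_adjoint T T'" "bounded_clinear T'"
    "\<And>y. (\<lambda>k. cinner y (T (e k)) *\<^sub>C e k) sums T' y"
proof -
  have orth: "\<And>i j. cinner (e i) (e j) = (if i = j then 1 else 0)"
    using e by (simp add: orthonormal_basis_def)
  obtain K where K: "K \<ge> 0" "\<And>x. norm (T x) \<le> K * norm x"
    using bounded_linear.nonneg_bounded[OF bounded_clinear_bounded_linear[OF T]]
    by (metis mult.commute)
  define T' where "T' y = (\<Sum>k. cinner y (T (e k)) *\<^sub>C e k)" for y
  have T': "(\<lambda>k. cinner y (T (e k)) *\<^sub>C e k) sums T' y" for y
    unfolding T'_def
    by (intro summable_sums orthonormal_summable[where M = "K * norm y"]
        orthonormal_bessel[OF orth T K] orth) auto
  have "cinner (T x) y = cinner x (T' y)" for x y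
  proof (rule sums_unique2)
    show "(\<lambda>k. cinner (T (cinner x (e k) *\<^sub>C e k)) y) sums cinner (T x) y"
      by (intro bounded_linear.sums[OF cinner.bounded_linear_left]
          bounded_linear.sums[OF bounded_clinear_bounded_linear[OF T]] orthonormal_basis_sums e)
    have "cinner (T (cinner x (e k) *\<^sub>C e k)) y = cinner x (cinner y (T (e k)) *\<^sub>C e k)" for k
      using cinner_commute[of "T (e k)" y]
      by (simp add: bounded_clinear_scaleC[OF T] cinner_scaleC_left cinner_scaleC_right)
    then show "(\<lambda>k. cinner (T (cinner x (e k) *\<^sub>C e k)) y) sums cinner x (T' y)"
      by (simp add: bounded_linear.sums[OF cinner.bounded_linear_right T'])
  qed
  then have "is_adjoint T T'" by (simp add: is_adjoint_def)
  then show ?thesis using that T' bounded_clinear_adjoint[OF T] by blast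
qed

text \<open>The sequence \<open>W e\<^sub>k\<close> is the dual basis of \<open>f\<close>, where \<open>f\<^sub>k = U e\<^sub>k\<close> and \<open>W = (U\<^sup>*)\<^sup>-\<^sup>1\<close>.\<close>

lemma riesz_basis_dual:
  fixes f :: "nat \<Rightarrow> 'a::chilbert_space"
  assumes "riesz_basis f"
  obtains e W where "orthonormal_basis e" "invertible_bounded_clinear W"
    "\<And>j k. cinner (W (e k)) (f j) = (if j = k then 1 else 0)"
    "\<And>x. (\<lambda>k. cinner x (f k) *\<^sub>C W (e k)) sums x"
    "\<And>k. frame_operator f (W (e k)) = f k"
    "inj (frame_operator f)"
proof -
  obtain U e where "invertible_bounded_clinear U" and e: "orthonormal_basis e"
    and f: "\<And>k. f k = U (e k)"
    using assms unfolding riesz_basis_def by blast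
  then obtain V where U: "bounded_clinear U"
    and V: "bounded_clinear V" "V \<circ> U = id" "U \<circ> V = id"
    unfolding invertible_bounded_clinear_def by blast
  obtain U' where U': "is_adjoint U U'" "bounded_clinear U'"
    "\<And>y. (\<lambda>k. cinner y (f k) *\<^sub>C e k) sums U' y"
    using adjoint_exists[OF e U, folded f] by blast
  obtain W where W: "is_adjoint V W" "bounded_clinear W"
    using adjoint_exists[OF e V(1)] by blast
  have U'W: "U' \<circ> W = id" by (rule is_adjoint_compose_id[OF W(1) U'(1) V(2)])
  have WU': "W \<circ> U' = id" by (rule is_adjoint_compose_id[OF U'(1) W(1) V(3)])
  \<comment> \<open>Applying \<open>U\<close> termwise to the series of \<open>U' x\<close> gives
    the frame series, together with its convergence.\<close>
  have S: "frame_operator f x = U (U' x)" for x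
    using bounded_linear.sums[OF bounded_clinear_bounded_linear[OF U] U'(3)[of x]]
    unfolding frame_operator_def by (simp add: f bounded_clinear_scaleC[OF U] sums_iff)
  show ?thesis
  proof
    show "orthonormal_basis e" by fact
    show "invertible_bounded_clinear W"
      unfolding invertible_bounded_clinear_def using W U' U'W WU' by blast
    show "cinner (W (e k)) (f j) = (if j = k then 1 else 0)" for j k
    proof -
      have "cinner (W (e k)) (f j) = cnj (cinner (U (e j)) (W (e k)))"
        unfolding f by (rule cinner_commute)
      also have "cinner (U (e j)) (W (e k)) = cinner (V (U (e j))) (e k)"
        using W(1) by (simp add: is_adjoint_def)
      also have "V (U (e j)) = e j" using V(2) by (metis comp_apply id_apply)
      finally show ?thesis using e by (simp add: orthonormal_basis_def)
    qed
    show "(\<lambda>k. cinner x (f k) *\<^sub>C W (e k)) sums x" for x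
      using bounded_linear.sums[OF bounded_clinear_bounded_linear[OF W(2)] U'(3)[of x]] WU'
      by (simp add: bounded_clinear_scaleC[OF W(2)] fun_eq_iff)
    show "frame_operator f (W (e k)) = f k" for k
      using U'W by (simp add: S f fun_eq_iff)
    \<comment> \<open>\<open>W \<circ> V\<close> is a left inverse of
      \<open>U \<circ> U'\<close>.\<close>
    show "inj (frame_operator f)"
      by (rule inj_on_inverseI[where g = "W \<circ> V"]) (use V(2) WU' in \<open>simp add: S fun_eq_iff\<close>)
  qed
qed

section \<open>The operator of a biframe\<close>

text \<open>The operator is \<open>T x\<close>, the sum of
  \<open>cinner x (f k) *\<^sub>C g k\<close>. The biframe bounds only control the diagonal of its
  form, so norm estimates on finite combinations come first and give the convergence of this
  series.\<close>

lemma biframe_operator: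
  fixes d f g :: "nat \<Rightarrow> 'a::chilbert_space"
  assumes "biframe f g"
    and dual: "\<And>j k. cinner (d k) (f j) = (if j = k then 1 else 0)"
    and expand: "\<And>x. (\<lambda>k. cinner x (f k) *\<^sub>C d k) sums x"
  obtains T A where "bounded_clinear T" "positive_operator T" "\<And>k. T (d k) = g k"
    "A > 0" "\<And>x. A * (norm x)\<^sup>2 \<le> Re (cinner (T x) x)"
proof -
  obtain A B where A: "A > 0" and B: "B > 0" and biframe: "\<And>x. \<exists>s::real.
      (\<lambda>k. cinner x (f k) * cinner (g k) x) sums complex_of_real s
      \<and> A * (norm x)\<^sup>2 \<le> s \<and> s \<le> B * (norm x)\<^sup>2"
    using assms(1) unfolding biframe_def by blast
  define D where "D I c = (\<Sum>k\<in>I. c k *\<^sub>C d k)" for I and c :: "nat \<Rightarrow> complex"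
  define G where "G I c = (\<Sum>k\<in>I. c k *\<^sub>C g k)" for I and c :: "nat \<Rightarrow> complex"
  have coeff: "cinner (D I c) (f k) = (if k \<in> I then c k else 0)" if "finite I" for I c k
    using that by (simp add: D_def cinner.sum_left cinner_scaleC_left dual
        if_distrib[of "\<lambda>z. _ * z"] cong: if_cong)
  \<comment> \<open>By biorthogonality the biframe series at \<open>D I c\<close> has finitely many
    nonzero terms, and its sum is this value of the form.\<close>
  have form: "Im (cinner (G I c) (D I c)) = 0 \<and> 0 \<le> Re (cinner (G I c) (D I c))
      \<and> Re (cinner (G I c) (D I c)) \<le> B * (norm (D I c))\<^sup>2" if I: "finite I" for I c
  proof -
    obtain s where s: "(\<lambda>k. cinner (D I c) (f k) * cinner (g k) (D I c)) sums complex_of_real s"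
      and bounds: "A * (norm (D I c))\<^sup>2 \<le> s" "s \<le> B * (norm (D I c))\<^sup>2"
      using biframe by blast
    have "(\<lambda>k. cinner (D I c) (f k) * cinner (g k) (D I c)) sums
        (\<Sum>k\<in>I. cinner (D I c) (f k) * cinner (g k) (D I c))"
      by (rule sums_finite) (simp_all add: I coeff)
    moreover have "(\<Sum>k\<in>I. cinner (D I c) (f k) * cinner (g k) (D I c)) = cinner (G I c) (D I c)"
      by (simp add: I coeff G_def cinner.sum_left cinner_scaleC_left)
    ultimately have "cinner (G I c) (D I c) = complex_of_real s"
      using s sums_unique2 by metis
    moreover have "0 \<le> A * (norm (D I c))\<^sup>2" using A by simp
    ultimately show ?thesis using bounds by simp
  qed
  \<comment> \<open>Since \<open>D\<close> and \<open>G\<close> are both linear in the coefficients,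
    Cauchy-Schwarz applies to coefficient sequences over a common index set.\<close>
  have cs: "cmod (cinner (G I a) (D I b)) \<le> B * norm (D I a) * norm (D I b)"
    if I: "finite I" for I a b
  proof (rule power2_le_imp_le)
    have D: "D I (\<lambda>k. a k + t * b k) = D I a + t *\<^sub>C D I b"
      and G: "G I (\<lambda>k. a k + t * b k) = G I a + t *\<^sub>C G I b" for t
      by (simp_all add: D_def G_def scaleC_add_left sum.distrib scaleC_sum_right scaleC_scaleC)
    have "cinner (G I a) (D I a) + cnj t * cinner (G I a) (D I b) + t * cinner (G I b) (D I a)
          + t * cnj t * cinner (G I b) (D I b)
        = cinner (G I (\<lambda>k. a k + t * b k)) (D I (\<lambda>k. a k + t * b k))" for t
      unfolding D G by (simp add: cinner_add_left cinner_add_right cinner_scaleC_left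
          cinner_scaleC_right algebra_simps)
    then have "(cmod (cinner (G I a) (D I b)))\<^sup>2
        \<le> Re (cinner (G I a) (D I a)) * Re (cinner (G I b) (D I b))"
      using form[OF I] by (intro hermitian_cauchy_schwarz(2)[where w' = "cinner (G I b) (D I a)"])
        (simp_all add: complex_is_Real_iff)
    also have "\<dots> \<le> (B * (norm (D I a))\<^sup>2) * (B * (norm (D I b))\<^sup>2)"
      using form[OF I] B by (intro mult_mono) auto
    finally show "(cmod (cinner (G I a) (D I b)))\<^sup>2 \<le> (B * norm (D I a) * norm (D I b))\<^sup>2"
      by (simp add: power2_eq_square algebra_simps)
  qed (use B in simp)
  \<comment> \<open>The vector \<open>G I c\<close> is tested against itself, approximated by
    partial sums of its expansion in the \<open>d k\<close>. Padding \<open>c\<close> with zeros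
    puts both arguments over \<open>{..<n}\<close>.\<close>
  have GD: "norm (G I c) \<le> B * norm (D I c)" if I: "finite I" for I c
  proof -
    let ?y = "G I c"
    let ?yn = "\<lambda>n. D {..<n} (\<lambda>k. cinner ?y (f k))"
    have yn: "?yn \<longlonglongrightarrow> ?y" using expand[of ?y] by (simp add: sums_def D_def)
    obtain N where N: "I \<subseteq> {..<N}" using I finite_nat_iff_bounded by blast
    have "cmod (cinner ?y (?yn n)) \<le> B * norm (D I c) * norm (?yn n)" if "n \<ge> N" for n
    proof -
      let ?c = "\<lambda>k. if k \<in> I then c k else 0"
      have "I \<subseteq> {..<n}" using N that by auto
      then have "D {..<n} ?c = D I c" "G {..<n} ?c = G I c"
        unfolding D_def G_def by (auto intro!: sum.mono_neutral_cong_right)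
      then show ?thesis using cs[of "{..<n}" ?c "\<lambda>k. cinner ?y (f k)"] by simp
    qed
    then have "cmod (cinner ?y ?y) \<le> B * norm (D I c) * norm ?y"
      by (intro LIMSEQ_le[OF tendsto_norm[OF cinner.tendsto[OF tendsto_const yn]]
            tendsto_mult[OF tendsto_const tendsto_norm[OF yn]]]) blast
    then have "(norm ?y)\<^sup>2 \<le> B * norm (D I c) * norm ?y" by (simp add: cinner_self norm_power)
    then show ?thesis
      using B by (cases "?y = 0") (simp_all add: power2_eq_square)
  qed
  define T where "T x = (\<Sum>k. cinner x (f k) *\<^sub>C g k)" for x
  \<comment> \<open>\<open>GD\<close> turns Cauchy blocks of the expansion of \<open>x\<close> into
    Cauchy blocks of this series.\<close>
  have T: "(\<lambda>k. cinner x (f k) *\<^sub>C g k) sums T x" for x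
    unfolding T_def
  proof (rule summable_sums, unfold summable_Cauchy, intro allI impI)
    fix \<epsilon> :: real assume "\<epsilon> > 0"
    then have "\<epsilon> / B > 0" using B by simp
    then obtain N where N: "\<And>m n. m \<ge> N \<Longrightarrow> norm (D {m..<n} (\<lambda>k. cinner x (f k))) < \<epsilon> / B"
      using sums_summable[OF expand[of x]] unfolding summable_Cauchy D_def by meson
    have "norm (\<Sum>k=m..<n. cinner x (f k) *\<^sub>C g k) < \<epsilon>" if "m \<ge> N" for m n
      using GD[of "{m..<n}" "\<lambda>k. cinner x (f k)"] N[OF that, of n] B
      unfolding G_def by (simp add: field_simps)
    then show "\<exists>N. \<forall>m\<ge>N. \<forall>n. norm (\<Sum>k=m..<n. cinner x (f k) *\<^sub>C g k) < \<epsilon>" by blast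
  qed
  have T_bounded: "bounded_clinear T"
  proof (rule bounded_clinearI)
    show "T (x + y) = T x + T y" for x y
      using sums_add[OF T[of x] T[of y]] T[of "x + y"]
      by (simp add: cinner_add_left scaleC_add_left sums_iff)
    show "T (c *\<^sub>C x) = c *\<^sub>C T x" for c x
      using bounded_linear.sums[OF bounded_linear_scaleC T[of x], of c] T[of "c *\<^sub>C x"]
      by (simp add: cinner_scaleC_left scaleC_scaleC sums_iff)
    show "norm (T x) \<le> B * norm x" for x
    proof (rule LIMSEQ_le)
      show "(\<lambda>n. norm (G {..<n} (\<lambda>k. cinner x (f k)))) \<longlonglongrightarrow> norm (T x)"
        using T[of x] unfolding sums_def G_def by (rule tendsto_norm)
      show "(\<lambda>n. B * norm (D {..<n} (\<lambda>k. cinner x (f k)))) \<longlonglongrightarrow> B * norm x"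
        using expand[of x] unfolding sums_def D_def by (intro tendsto_mult tendsto_const tendsto_norm)
    qed (use GD in blast)
  qed
  \<comment> \<open>Pairing the series of \<open>T x\<close> with \<open>x\<close> gives back the
    biframe series.\<close>
  have Tx: "\<exists>s. cinner (T x) x = complex_of_real s \<and> A * (norm x)\<^sup>2 \<le> s" for x
    using biframe[of x] bounded_linear.sums[OF cinner.bounded_linear_left T[of x], of x]
    by (auto simp: cinner_scaleC_left dest: sums_unique2)
  show ?thesis
  proof
    show "bounded_clinear T" by fact
    show "A > 0" by fact
    show coercive: "A * (norm x)\<^sup>2 \<le> Re (cinner (T x) x)" for x using Tx[of x] by auto
    show "positive_operator T"
      unfolding positive_operator_def
    proof (intro allI conjI)
      show "cinner (T x) x \<in> \<real>" for x using Tx[of x] by auto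
      show "0 \<le> Re (cinner (T x) x)" for x
        by (rule order_trans[OF _ coercive]) (use A in simp)
    qed
    show "T (d k) = g k" for k
    proof -
      have "(\<lambda>j. cinner (d k) (f j) *\<^sub>C g j) sums (\<Sum>j\<in>{k}. cinner (d k) (f j) *\<^sub>C g j)"
        by (rule sums_finite) (simp_all add: dual)
      then show ?thesis using T[of "d k"] by (simp add: dual sums_iff)
    qed
  qed
qed

section \<open>Inverses of positive operators, and the equivalence\<close>

text \<open>Positivity is that of \<open>T\<close> at the vector \<open>Q x\<close>, and the lower
  bound for \<open>Q\<close> is the upper bound for \<open>T\<close>. The theorem applies this in
  both directions, with the two operators exchanged.\<close>

lemma positive_inverse_Bbb_pos:
  fixes T Q :: "'a::chilbert_space \<Rightarrow> 'a"
  assumes T: "bounded_clinear T" "positive_operator T" and Q: "bounded_clinear Q" "T \<circ> Q = id" "Q \<circ> T = id"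
  shows "Q \<in> Bbb_pos"
proof -
  have TQ: "T (Q x) = x" and QT: "Q (T x) = x" for x
    using Q by (simp_all add: fun_eq_iff)
  have form: "cinner (Q x) x = cnj (cinner (T (Q x)) (Q x))" for x
    by (metis TQ cinner_commute)
  have pos: "positive_operator Q"
    using T(2) unfolding positive_operator_def form by (simp add: complex_is_Real_iff)
  obtain K where K: "K > 0" "\<And>x. norm (T x) \<le> norm x * K"
    using bounded_linear.pos_bounded[OF bounded_clinear_bounded_linear[OF T(1)]] by blast
  have "(1 / K) * norm x \<le> norm (Q x)" for x
    using K(2)[of "Q x"] K(1) by (simp add: TQ field_simps)
  then have "bounded_below_operator Q"
    unfolding bounded_below_operator_def using K(1) by (intro exI[of _ "1 / K"]) simp
  then show ?thesis
    using Q(1) pos positive_operator_self_adjoint[OF Q(1) pos] by (simp add: Bbb_pos_def)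
qed

theorem theorem5p4:
  fixes f g :: "nat \<Rightarrow> 'a::chilbert_space"
  assumes "separable_space (euclidean :: 'a topology)"
    and "riesz_basis f"
  shows "(biframe f g \<longleftrightarrow> (\<exists>Q\<in>Bbb_pos. \<forall>k. g k = inv (frame_operator f \<circ> Q) (f k)))
    \<and> (biframe f g \<longrightarrow> riesz_basis g)
    \<and> ((\<exists>Q\<in>Bbb_pos. \<forall>k. g k = inv (frame_operator f \<circ> Q) (f k)) \<longrightarrow> riesz_basis g)"
proof -
  let ?ii = "\<exists>Q\<in>Bbb_pos. \<forall>k. g k = inv (frame_operator f \<circ> Q) (f k)"
  obtain e W where e: "orthonormal_basis e" and W: "invertible_bounded_clinear W"
    and dual: "\<And>j k. cinner (W (e k)) (f j) = (if j = k then 1 else 0)"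
    and expand: "\<And>x. (\<lambda>k. cinner x (f k) *\<^sub>C W (e k)) sums x"
    and S: "\<And>k. frame_operator f (W (e k)) = f k" "inj (frame_operator f)"
    using riesz_basis_dual[OF assms(2)] by blast
  \<comment> \<open>Injectivity lets \<open>inv\<close> be computed from one explicit preimage of
    \<open>f k\<close>.\<close>
  have inv_SQ: "inv (frame_operator f \<circ> Q) (f k) = T (W (e k))"
    if "T \<circ> Q = id" "Q \<circ> T = id" for Q T k
  proof -
    have "inj Q" by (metis that(1) inj_on_id inj_on_imageI2)
    then have "inj (frame_operator f \<circ> Q)" using S(2) by (simp add: inj_compose)
    moreover have "(frame_operator f \<circ> Q) (T (W (e k))) = f k"
      using that(2) by (simp add: fun_eq_iff S(1))
    ultimately show ?thesis by (metis inv_f_f)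
  qed
  have 1: ?ii if bf: "biframe f g"
  proof -
    obtain T A where T: "bounded_clinear T" "positive_operator T" "\<And>k. T (W (e k)) = g k"
      and A: "A > 0" "\<And>x. A * (norm x)\<^sup>2 \<le> Re (cinner (T x) x)"
      using biframe_operator[OF bf dual expand] by blast
    obtain Q where Q: "bounded_clinear Q" "Q \<circ> T = id" "T \<circ> Q = id"
      using invertible_if_coercive[OF T(1) A] unfolding invertible_bounded_clinear_def by blast
    have "Q \<in> Bbb_pos" by (rule positive_inverse_Bbb_pos[OF T(1,2) Q(1,3,2)])
    moreover have "g k = inv (frame_operator f \<circ> Q) (f k)" for k
      by (simp add: inv_SQ[OF Q(3,2)] T(3))
    ultimately show ?thesis by blast
  qed
  \<comment> \<open>Both consequences of (ii) are derived together; chained with the previous step,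
    this also covers the Riesz property under (i).\<close>
  have 2: "biframe f g \<and> riesz_basis g" if ?ii
  proof -
    obtain Q where Q: "Q \<in> Bbb_pos" and gQ: "\<And>k. g k = inv (frame_operator f \<circ> Q) (f k)"
      using \<open>?ii\<close> by blast
    have Qb: "bounded_clinear Q" "positive_operator Q" using Q by (auto simp: Bbb_pos_def)
    obtain A where A: "A > 0" "\<And>x. A * (norm x)\<^sup>2 \<le> Re (cinner (Q x) x)"
      using Bbb_pos_coercive[OF Q] by blast
    obtain T where T: "bounded_clinear T" "T \<circ> Q = id" "Q \<circ> T = id"
      using invertible_if_coercive[OF Qb(1) A] unfolding invertible_bounded_clinear_def by blast
    have g: "g k = T (W (e k))" for k by (simp add: gQ inv_SQ[OF T(2,3)])
    have "invertible_bounded_clinear T"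
      unfolding invertible_bounded_clinear_def using T Qb(1) by blast
    then have "invertible_bounded_clinear (T \<circ> W)"
      using W by (rule invertible_bounded_clinear_compose)
    then have riesz: "riesz_basis g"
      unfolding riesz_basis_def using e g by (intro exI[of _ "T \<circ> W"] exI[of _ e]) simp
    \<comment> \<open>The lower biframe bound is the coercivity constant of the inverse
      \<open>T\<close>, the upper one its norm bound \<open>K\<close>.\<close>
    have "T \<in> Bbb_pos" by (rule positive_inverse_Bbb_pos[OF Qb T(1,3,2)])
    then obtain A' where A': "A' > 0" "\<And>x. A' * (norm x)\<^sup>2 \<le> Re (cinner (T x) x)"
      by (rule Bbb_pos_coercive) blast
    obtain K where K: "K > 0" "\<And>x. norm (T x) \<le> norm x * K"
      using bounded_linear.pos_bounded[OF bounded_clinear_bounded_linear[OF T(1)]] by blast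
    \<comment> \<open>Apply \<open>T\<close> to the dual expansion of \<open>x\<close>, then pair
      with \<open>x\<close>; the form is real because \<open>T\<close> is positive.\<close>
    have series: "(\<lambda>k. cinner x (f k) * cinner (g k) x) sums complex_of_real (Re (cinner (T x) x))" for x
    proof -
      have "(\<lambda>k. cinner (T (cinner x (f k) *\<^sub>C W (e k))) x) sums cinner (T x) x"
        by (intro bounded_linear.sums[OF cinner.bounded_linear_left]
            bounded_linear.sums[OF bounded_clinear_bounded_linear[OF T(1)]] expand)
      then show ?thesis
        using \<open>T \<in> Bbb_pos\<close>
        by (simp add: Bbb_pos_def positive_operator_def bounded_clinear_scaleC[OF T(1)]
            cinner_scaleC_left g)
    qed
    have upper: "Re (cinner (T x) x) \<le> K * (norm x)\<^sup>2" for x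
    proof -
      have "Re (cinner (T x) x) \<le> norm (T x) * norm x"
        using complex_Re_le_cmod cinner_cauchy_schwarz order_trans by blast
      also have "\<dots> \<le> norm x * K * norm x" by (intro mult_right_mono K) simp
      finally show ?thesis by (simp add: power2_eq_square mult_ac)
    qed
    have "biframe f g"
      unfolding biframe_def using A' K(1) series upper by blast
    then show ?thesis using riesz ..
  qed
  show ?thesis using 1 2 by blast
qed

end
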